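(* Let $G$ be a graph of pathwidth $k$. Then $\chi_c^{\bullet}(G)\leq k+1$.
   Context: All graphs are finite and simple. The pathwidth of $G$ is the minimum over all path decompositions of $G$ (sequences of vertex subsets $X_1,\dots,X_r$ covering every vertex and both ends of every edge, such that for each vertex the indices of bags containing it form an interval) of $\max_i |X_i|-1$. A correspondence-cover of a graph $G$ is a pair $(L,H)$ where $H$ is a graph and $L:V(G)\to 2^{V(H)}$ satisfies: the sets $L(v)$, $v\in V(G)$, partition $V(H)$; each $L(v)$ induces a clique in $H$; if $uv\notin E(G)$ ($u\ne v$) there are no edges of $H$ between $L(u)$ and $L(v)$; if $uv\in E(G)$ the edges of $H$ between $L(u)$ and $L(v)$ form a matching. It is $k$-fold if $|L(v)|=k$ for all $v$. An independent transversal of $(L,H)$ is an independent set $I$ of $H$ with $|I\cap L(v)|=1$ for every $v$. The cover admits a fractional packing if there is a probability distribution on independent transversals $I$ such that $\mathbb{P}(x\in I)\ge 1/|L(v)|$ for every $v\in V(G)$ and every $x\in L(v)$. The fractional correspondence packing number $\chi_c^{\bullet}(G)$ is the least integer $k$ such that every $k$-fold correspondence-cover of $G$ admits a fractional packing. *)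

theory Defs
  imports
    "Graph_Theory.Pair_Digraph"
    "HOL-Library.Disjoint_Sets"
    "HOL-Probability.Probability_Mass_Function"
begin

text \<open>A finite simple graph is a \<^locale>\<open>pair_graph\<close>: a finite vertex set \<^term>\<open>pverts G\<close> with a
  symmetric, irreflexive edge relation \<^term>\<open>parcs G\<close> on it. The null graph is allowed.\<close>

definition path_decomposition :: "'a pair_pre_digraph \<Rightarrow> 'a set list \<Rightarrow> bool" where
  "path_decomposition G Xs \<longleftrightarrow>
     Xs \<noteq> [] \<and>
     (\<forall>X\<in>set Xs. X \<subseteq> pverts G) \<and>
     (\<forall>v\<in>pverts G. \<exists>X\<in>set Xs. v \<in> X) \<and>
     (\<forall>u v. (u, v) \<in> parcs G \<longrightarrow> (\<exists>X\<in>set Xs. u \<in> X \<and> v \<in> X)) \<and>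
     (\<forall>v\<in>pverts G. \<forall>i j l. i \<le> j \<and> j \<le> l \<and> l < length Xs \<and> v \<in> Xs ! i \<and> v \<in> Xs ! l
        \<longrightarrow> v \<in> Xs ! j)"

definition decomposition_width :: "'a set list \<Rightarrow> int" where
  "decomposition_width Xs = Max ((\<lambda>X. int (card X)) ` set Xs) - 1"

text \<open>The null graph has pathwidth \<open>-1\<close>, so widths are integers. The minimum is over a nonempty
  finite set; see \<open>path_decomposition_widths\<close> below.\<close>

definition pathwidth :: "'a pair_pre_digraph \<Rightarrow> int" where
  "pathwidth G = Min {decomposition_width Xs | Xs. path_decomposition G Xs}"

lemma path_decomposition_widths:
  assumes "pair_graph G"
  shows "finite {decomposition_width Xs | Xs. path_decomposition G Xs}"
    and "{decomposition_width Xs | Xs. path_decomposition G Xs} \<noteq> {}"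
proof -
  interpret pair_graph G by fact
  have "decomposition_width Xs \<in> {-1..int (card (pverts G))}" if "path_decomposition G Xs" for Xs
  proof -
    let ?A = "(\<lambda>X. int (card X)) ` set Xs"
    have fin: "finite ?A" and ne: "?A \<noteq> {}"
      using that by (auto simp: path_decomposition_def)
    have "a \<le> int (card (pverts G))" "0 \<le> a" if "a \<in> ?A" for a
      using that \<open>path_decomposition G Xs\<close> pair_finite_verts
      by (auto simp: path_decomposition_def card_mono)
    from this[OF Max_in[OF fin ne]] show ?thesis
      by (simp add: decomposition_width_def)
  qed
  then have "{decomposition_width Xs | Xs. path_decomposition G Xs} \<subseteq> {-1..int (card (pverts G))}"
    by blast
  then show "finite {decomposition_width Xs | Xs. path_decomposition G Xs}"
    by (rule finite_subset) simp
  have "path_decomposition G [pverts G]"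
    by (auto simp: path_decomposition_def dest: in_arcsD1 in_arcsD2)
  then show "{decomposition_width Xs | Xs. path_decomposition G Xs} \<noteq> {}"
    by blast
qed

definition edges_between :: "'b pair_pre_digraph \<Rightarrow> 'b set \<Rightarrow> 'b set \<Rightarrow> 'b set set" where
  "edges_between H A B = {{x, y} | x y. x \<in> A \<and> y \<in> B \<and> (x, y) \<in> parcs H}"

definition matching :: "'b set set \<Rightarrow> bool" where
  "matching M \<longleftrightarrow> pairwise disjnt M"

text \<open>The lists \<open>L v\<close> may be empty, so that a null graph, and only it, admits packings for all
  of its \<open>0\<close>-fold covers. Values of \<open>L\<close> outside \<^term>\<open>pverts G\<close> are irrelevant.\<close>

definition correspondence_cover ::
    "'a pair_pre_digraph \<Rightarrow> ('a \<Rightarrow> 'b set) \<Rightarrow> 'b pair_pre_digraph \<Rightarrow> bool" where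
  "correspondence_cover G L H \<longleftrightarrow>
     pair_graph H \<and>
     (\<Union>v\<in>pverts G. L v) = pverts H \<and> disjoint_family_on L (pverts G) \<and>
     (\<forall>v\<in>pverts G. \<forall>x\<in>L v. \<forall>y\<in>L v. x \<noteq> y \<longrightarrow> (x, y) \<in> parcs H) \<and>
     (\<forall>u\<in>pverts G. \<forall>v\<in>pverts G. u \<noteq> v \<and> (u, v) \<notin> parcs G \<longrightarrow>
        edges_between H (L u) (L v) = {}) \<and>
     (\<forall>u\<in>pverts G. \<forall>v\<in>pverts G. (u, v) \<in> parcs G \<longrightarrow>
        matching (edges_between H (L u) (L v)))"

definition k_fold :: "nat \<Rightarrow> 'a pair_pre_digraph \<Rightarrow> ('a \<Rightarrow> 'b set) \<Rightarrow> bool" where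
  "k_fold k G L \<longleftrightarrow> (\<forall>v\<in>pverts G. card (L v) = k)"

definition independent_set :: "'b pair_pre_digraph \<Rightarrow> 'b set \<Rightarrow> bool" where
  "independent_set H I \<longleftrightarrow> I \<subseteq> pverts H \<and> (\<forall>x\<in>I. \<forall>y\<in>I. (x, y) \<notin> parcs H)"

definition independent_transversal ::
    "'a pair_pre_digraph \<Rightarrow> ('a \<Rightarrow> 'b set) \<Rightarrow> 'b pair_pre_digraph \<Rightarrow> 'b set \<Rightarrow> bool" where
  "independent_transversal G L H I \<longleftrightarrow>
     independent_set H I \<and> (\<forall>v\<in>pverts G. card (I \<inter> L v) = 1)"

definition admits_fractional_packing ::
    "'a pair_pre_digraph \<Rightarrow> ('a \<Rightarrow> 'b set) \<Rightarrow> 'b pair_pre_digraph \<Rightarrow> bool" where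
  "admits_fractional_packing G L H \<longleftrightarrow>
     (\<exists>p :: 'b set pmf.
        (\<forall>I\<in>set_pmf p. independent_transversal G L H I) \<and>
        (\<forall>v\<in>pverts G. \<forall>x\<in>L v. measure_pmf.prob p {I. x \<in> I} \<ge> 1 / real (card (L v))))"

text \<open>Cover graphs are taken on natural numbers because the definition cannot quantify over types.
  As cover graphs are finite, this is no restriction; see \<open>fractional_packing_any_type\<close> below.\<close>

definition fractional_correspondence_packing_number :: "'a pair_pre_digraph \<Rightarrow> nat" where
  "fractional_correspondence_packing_number G =
     (LEAST k. \<forall>(L :: 'a \<Rightarrow> nat set) (H :: nat pair_pre_digraph).
        correspondence_cover G L H \<and> k_fold k G L \<longrightarrow> admits_fractional_packing G L H)"

lemma fractional_packing_any_type:
  fixes L :: "'a \<Rightarrow> 'b set" and H :: "'b pair_pre_digraph"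
  assumes nat: "\<And>(L :: 'a \<Rightarrow> nat set) H. correspondence_cover G L H \<Longrightarrow> k_fold k G L
      \<Longrightarrow> admits_fractional_packing G L H"
    and cov: "correspondence_cover G L H" and fold: "k_fold k G L"
  shows "admits_fractional_packing G L H"
proof -
  interpret H: pair_graph H using cov by (simp add: correspondence_cover_def)
  obtain f :: "'b \<Rightarrow> nat" where inj: "inj_on f (pverts H)"
    using H.pair_finite_verts finite_imp_inj_to_nat_seg by metis
  define H' where "H' = \<lparr>pverts = f ` pverts H, parcs = map_prod f f ` parcs H\<rparr>"
  define L' where "L' v = f ` L v" for v
  have feq: "f x = f y \<longleftrightarrow> x = y" if "x \<in> pverts H" "y \<in> pverts H" for x y
    using inj that by (auto dest: inj_onD)
  have sub: "L v \<subseteq> pverts H" if "v \<in> pverts G" for v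
    using cov that by (auto simp: correspondence_cover_def)
  have arc: "(f x, f y) \<in> parcs H' \<longleftrightarrow> (x, y) \<in> parcs H" if "x \<in> pverts H" "y \<in> pverts H" for x y
  proof
    assume "(f x, f y) \<in> parcs H'"
    then obtain a b where "(a, b) \<in> parcs H" "f x = f a" "f y = f b"
      by (auto simp: H'_def)
    then show "(x, y) \<in> parcs H" using that feq H.in_arcsD1 H.in_arcsD2 by metis
  qed (auto simp: H'_def)
  have eb: "edges_between H' (L' u) (L' v) = image f ` edges_between H (L u) (L v)"
    if "u \<in> pverts G" "v \<in> pverts G" for u v
  proof -
    have "{f x, f y} \<in> image f ` edges_between H (L u) (L v)"
      if "x \<in> L u" "y \<in> L v" "(x, y) \<in> parcs H" for x y
      using that by (intro image_eqI[of _ _ "{x, y}"]) (auto simp: edges_between_def)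
    moreover have "f ` {x, y} \<in> edges_between H' (L' u) (L' v)"
      if "x \<in> L u" "y \<in> L v" "(x, y) \<in> parcs H" for x y
      using that unfolding edges_between_def L'_def H'_def by force
    ultimately show ?thesis
      using sub[OF that(1)] sub[OF that(2)] arc
      unfolding edges_between_def L'_def by (auto simp: subset_iff)
  qed
  have pg: "pair_graph H'"
  proof
    show "finite (pverts H')" "finite (parcs H')"
      by (auto simp: H'_def H.pair_finite_verts H.pair_finite_arcs)
    show "fst e \<in> pverts H'" "snd e \<in> pverts H'" if "e \<in> parcs H'" for e
      using that H.in_arcsD1 H.in_arcsD2 by (auto simp: H'_def)
    show "fst e \<noteq> snd e" if "e \<in> parcs H'" for e
      using that H.in_arcsD1 H.in_arcsD2 feq H.pair_no_loops by (fastforce simp: H'_def)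
    have "sym (parcs H)" using H.pair_sym_arcs by (simp add: symmetric_def)
    then show "symmetric (with_proj H')"
      by (auto simp: symmetric_def H'_def sym_def image_iff) (metis map_prod_simp)
  qed
  have "correspondence_cover G L' H'"
    unfolding correspondence_cover_def
  proof (intro conjI ballI impI)
    show "pair_graph H'" by (rule pg)
    show "(\<Union>v\<in>pverts G. L' v) = pverts H'"
      using cov by (simp add: correspondence_cover_def L'_def H'_def flip: image_UN)
    show "disjoint_family_on L' (pverts G)"
      unfolding disjoint_family_on_def
    proof (intro ballI impI)
      fix u v assume uv: "u \<in> pverts G" "v \<in> pverts G" "u \<noteq> v"
      then have "L u \<inter> L v = {}"
        using cov by (auto simp: correspondence_cover_def disjoint_family_on_def)
      then show "L' u \<inter> L' v = {}"
        using inj_on_image_Int[OF inj sub sub] uv by (metis L'_def image_empty)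
    qed
    show "(x, y) \<in> parcs H'" if xy: "v \<in> pverts G" "x \<in> L' v" "y \<in> L' v" "x \<noteq> y" for v x y
    proof -
      obtain a b where ab: "x = f a" "y = f b" "a \<in> L v" "b \<in> L v"
        using xy by (auto simp: L'_def)
      then have "a \<noteq> b"
        using xy by blast
      then have "(a, b) \<in> parcs H"
        using cov xy(1) ab(3,4) unfolding correspondence_cover_def by blast
      then show ?thesis
        using ab by (auto simp: H'_def)
    qed
    show "edges_between H' (L' u) (L' v) = {}"
      if "u \<in> pverts G" "v \<in> pverts G" "u \<noteq> v \<and> (u, v) \<notin> parcs G" for u v
      using that cov by (simp add: eb correspondence_cover_def)
    show "matching (edges_between H' (L' u) (L' v))"
      if uv: "u \<in> pverts G" "v \<in> pverts G" "(u, v) \<in> parcs G" for u v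
      unfolding matching_def eb[OF uv(1,2)]
    proof (rule pairwiseI)
      fix e e' assume *: "e \<in> image f ` edges_between H (L u) (L v)"
        "e' \<in> image f ` edges_between H (L u) (L v)" "e \<noteq> e'"
      then obtain d d' where d: "e = f ` d" "e' = f ` d'" "d \<in> edges_between H (L u) (L v)"
        "d' \<in> edges_between H (L u) (L v)" "d \<noteq> d'" by blast
      have "matching (edges_between H (L u) (L v))"
        using cov uv by (auto simp: correspondence_cover_def)
      then have "d \<inter> d' = {}"
        using d by (auto simp: matching_def pairwise_def disjnt_def)
      moreover have "d \<subseteq> pverts H" "d' \<subseteq> pverts H"
        using d(3,4) sub uv by (auto simp: edges_between_def)
      ultimately show "disjnt e e'"
        using inj_on_image_Int[OF inj] d(1,2) by (metis disjnt_def image_empty)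
    qed
  qed
  moreover have "k_fold k G L'"
    using fold inj_on_subset[OF inj sub] by (auto simp: k_fold_def L'_def card_image)
  ultimately obtain p where
    p: "\<And>I. I \<in> set_pmf p \<Longrightarrow> independent_transversal G L' H' I"
    "\<And>v x. v \<in> pverts G \<Longrightarrow> x \<in> L' v \<Longrightarrow>
      measure_pmf.prob p {I. x \<in> I} \<ge> 1 / real (card (L' v))"
    using nat[of L' H'] unfolding admits_fractional_packing_def by blast
  define g where "g I = {x \<in> pverts H. f x \<in> I}" for I
  show ?thesis
    unfolding admits_fractional_packing_def
  proof (intro exI conjI ballI)
    fix J assume "J \<in> set_pmf (map_pmf g p)"
    then obtain I where I: "I \<in> set_pmf p" "J = g I" by auto
    have "card (J \<inter> L v) = 1" if v: "v \<in> pverts G" for v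
    proof -
      have "f ` (J \<inter> L v) = I \<inter> L' v"
        using sub[OF v] by (auto simp: I(2) g_def L'_def)
      moreover have "inj_on f (J \<inter> L v)"
        using inj by (rule inj_on_subset) (auto simp: I(2) g_def)
      ultimately show ?thesis
        using p(1)[OF I(1)] v by (metis card_image independent_transversal_def)
    qed
    moreover have "independent_set H J"
      using p(1)[OF I(1)] arc
      by (auto simp: independent_transversal_def independent_set_def I(2) g_def) (metis arc)
    ultimately show "independent_transversal G L H J"
      by (simp add: independent_transversal_def)
  next
    fix v x assume v: "v \<in> pverts G" and x: "x \<in> L v"
    have "g -` {J. x \<in> J} = {I. f x \<in> I}"
      using sub[OF v] x by (auto simp: g_def)
    moreover have "card (L' v) = card (L v)"
      using inj_on_subset[OF inj sub[OF v]] by (simp add: L'_def card_image)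
    ultimately show "measure_pmf.prob (map_pmf g p) {J. x \<in> J} \<ge> 1 / real (card (L v))"
      using p(2)[OF v, of "f x"] x by (simp add: L'_def)
  qed
qed

end

theory Submission
  imports Defs
begin

text \<open>Let \<open>m = k + 1\<close>. Colour the vertices in the order in which they first occur in the bags, keeping
  a family of \<open>m!\<close> colourings and listing the vertices still alive by decreasing last occurrence,
  so that vertices leave the list at its end. The invariant is that fixing the colours of the first
  \<open>j\<close> listed vertices leaves exactly \<open>(m - j)!\<close> members of the family. A new vertex meets at most \<open>k\<close>
  living ones; going down the list, each of them forbids at most one of the colours
  still possible, and completing the conflict matchings to bijections makes each of these colours
  be deleted equally often. The resulting
  colour of the new vertex is such that it can be inserted at every position of the list without
  destroying the invariant: at its proper place to continue, and at the front to see
  that its colour is uniform.\<close>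

section \<open>Families of colourings with factorial fibre sizes\<close>

text \<open>Members of the family are indices in \<open>C\<close> and a vertex is the function
  giving its colour at each index. Equal colourings thus count with multiplicity, and conditioning
  on a colour means passing to a subset of \<open>C\<close>. The order of the list matters: for
  \<open>r = 2\<close>, \<open>u\<close> injective and \<open>v\<close> constant,
  \<open>[u, v]\<close> is balanced but \<open>[v, u]\<close> is not.\<close>

primrec balanced :: "nat \<Rightarrow> 'i set \<Rightarrow> ('i \<Rightarrow> 'c) list \<Rightarrow> bool" where
  "balanced r C [] \<longleftrightarrow> card C = fact r"
| "balanced r C (u # us) \<longleftrightarrow> card C = fact r \<and>
     (\<forall>a\<in>u ` C. balanced (r - 1) {t \<in> C. u t = a} us)"

lemma balanced_card: "balanced r C us \<Longrightarrow> card C = fact r"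
  by (cases us) auto

lemma balanced_finite: "balanced r C us \<Longrightarrow> finite C"
  using balanced_card[of r C us] card_ge_0_finite[of C] by simp

lemma balanced_append1: "balanced r C (us @ vs) \<Longrightarrow> balanced r C us"
  by (induction us arbitrary: r C) (auto dest: balanced_card)

text \<open>Only values on \<open>C\<close> enter the recursion. This allows colour functions built
  separately on each fibre to be replaced by the one function glued from them.\<close>

lemma balanced_cong:
  assumes "list_all2 (\<lambda>u v. \<forall>t\<in>C. u t = v t) us vs"
  shows "balanced r C us \<longleftrightarrow> balanced r C vs"
  using assms
proof (induction us arbitrary: r C vs)
  case (Cons u us)
  then obtain w ws where vs: "vs = w # ws"
    and eq: "\<And>t. t \<in> C \<Longrightarrow> u t = w t" and rest: "list_all2 (\<lambda>u v. \<forall>t\<in>C. u t = v t) us ws"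
    by (auto simp: list_all2_Cons1)
  have "u ` C = w ` C" using eq by (intro image_cong) auto
  moreover have "{t \<in> C. u t = a} = {t \<in> C. w t = a}" for a using eq by auto
  moreover have "balanced (r - 1) {t \<in> C. w t = a} us \<longleftrightarrow> balanced (r - 1) {t \<in> C. w t = a} ws" for a
    by (rule Cons.IH) (rule list_all2_mono[OF rest], auto)
  ultimately show ?case by (simp add: vs)
qed simp

lemma card_eq_sum_fibres:
  assumes "finite C"
  shows "card C = (\<Sum>a\<in>u ` C. card {t \<in> C. u t = a})"
  using sum.image_gen[OF assms, of "\<lambda>_. 1::nat" u] by simp

text \<open>The \<open>fact r\<close> indices split into fibres of size \<open>fact (r - 1)\<close>,
  which leaves room for exactly \<open>r\<close> of them.\<close>

lemma balanced_Cons_card_image: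
  assumes "balanced r C (u # us)" "0 < r"
  shows "card (u ` C) = r"
proof -
  have "card C = (\<Sum>a\<in>u ` C. fact (r - 1))"
    unfolding card_eq_sum_fibres[OF balanced_finite[OF assms(1)], of u]
    by (rule sum.cong) (use assms(1) in \<open>auto dest: balanced_card\<close>)
  then have "fact r = card (u ` C) * fact (r - 1)"
    using assms(1) by simp
  then show ?thesis
    using fact_reduce[OF assms(2), where 'a = nat] by simp
qed

lemma balanced_Cons_image_eq:
  assumes "balanced r C (u # us)" "0 < r" "u ` C \<subseteq> A" "card A = r"
  shows "u ` C = A"
  using assms balanced_Cons_card_image[OF assms(1,2)] by (metis card_gt_0_iff card_subset_eq)

section \<open>Conflict matchings and the insertion of a new vertex\<close>

text \<open>Between \<open>S\<close> and \<open>A\<close> the relation is a partial injection. It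
  may leave elements on either side without a partner.\<close>

definition matched :: "('c \<Rightarrow> 'd \<Rightarrow> bool) \<Rightarrow> 'c set \<Rightarrow> 'd set \<Rightarrow> bool" where
  "matched R S A \<longleftrightarrow> (\<forall>a\<in>S. \<forall>a'\<in>S. \<forall>b\<in>A. \<forall>b'\<in>A. R a b \<and> R a' b' \<longrightarrow> (a = a' \<longleftrightarrow> b = b'))"

lemma matched_subset: "matched R S A \<Longrightarrow> S' \<subseteq> S \<Longrightarrow> A' \<subseteq> A \<Longrightarrow> matched R S' A'"
  unfolding matched_def by blast

text \<open>The conflicts define an injection on part of \<open>S\<close>. As \<open>S\<close> and
  \<open>A\<close> have equal size, so do the two unmatched remainders, and any bijection between
  these completes it.\<close>

lemma matched_extends_bij_betw:
  assumes "matched R S A" "finite S" "finite A" "card S = card A"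
  obtains \<phi> where "bij_betw \<phi> S A" "\<And>a b. a \<in> S \<Longrightarrow> b \<in> A \<Longrightarrow> R a b \<Longrightarrow> \<phi> a = b"
proof -
  define D where "D = {a \<in> S. \<exists>b\<in>A. R a b}"
  define g where "g a = (SOME b. b \<in> A \<and> R a b)" for a
  have g: "g a \<in> A \<and> R a (g a)" if "a \<in> D" for a
    unfolding g_def by (rule someI_ex) (use that D_def in blast)
  have DS: "D \<subseteq> S" by (auto simp: D_def)
  have inj: "inj_on g D"
    using assms(1) g DS unfolding matched_def inj_on_def by (metis subsetD)
  have EA: "g ` D \<subseteq> A" using g by auto
  have "card (S - D) = card (A - g ` D)"
    using assms DS EA card_image[OF inj] by (simp add: card_Diff_subset finite_subset)
  then obtain h where h: "bij_betw h (S - D) (A - g ` D)"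
    using assms by (metis finite_Diff finite_same_card_bij)
  define \<phi> where "\<phi> a = (if a \<in> D then g a else h a)" for a
  have "bij_betw \<phi> D (g ` D)"
    using inj by (simp add: \<phi>_def bij_betw_def inj_on_def image_def)
  moreover have "bij_betw \<phi> (S - D) (A - g ` D)"
    using h by (rule bij_betw_cong[THEN iffD1, rotated]) (simp add: \<phi>_def)
  ultimately have "bij_betw \<phi> (D \<union> (S - D)) (g ` D \<union> (A - g ` D))"
    by (rule bij_betw_combine) auto
  moreover have "D \<union> (S - D) = S" "g ` D \<union> (A - g ` D) = A"
    using DS EA by auto
  moreover have "\<phi> a = b" if "a \<in> S" "b \<in> A" "R a b" for a b
  proof -
    have "a \<in> D" using that D_def by blast
    then show ?thesis
      using assms(1) g[of a] that by (simp add: \<phi>_def) (metis matched_def)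
  qed
  ultimately show thesis using that by simp
qed

text \<open>Induction on the list: condition on the colour of its head, delete one colour from
  \<open>A\<close>, and treat the tail inside each fibre. Since the list is shorter than
  \<open>r\<close>, a colour survives all deletions. All positions are claimed at once because the
  front position for the tail is what yields the front position for the whole list.\<close>

lemma balanced_insert:
  assumes "balanced r C us" "length us < r" "card A = r"
    and "\<And>u. u \<in> set us \<Longrightarrow> matched R (u ` C) A"
  shows "\<exists>x. x ` C \<subseteq> A \<and> (\<forall>t\<in>C. \<forall>u\<in>set us. \<not> R (u t) (x t)) \<and>
    (\<forall>i\<le>length us. balanced r C (take i us @ x # drop i us))"
  using assms
proof (induction us arbitrary: r C A)
  case Nil
  have fin: "finite C" "finite A"
    using Nil balanced_finite card_ge_0_finite by fastforce+
  \<comment> \<open>With no conflicts left, cut \<open>C\<close> into \<open>r\<close> classes of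
    size \<open>fact (r - 1)\<close>, one per colour: the first coordinate of a bijection onto this
    product is the new colour.\<close>
  have "card C = card (A \<times> {..<fact (r - 1) :: nat})"
    using Nil fact_reduce[of r, where 'a = nat] by (simp add: card_cartesian_product)
  then obtain h where h: "bij_betw h C (A \<times> {..<fact (r - 1) :: nat})"
    using fin by (metis finite_SigmaI finite_lessThan finite_same_card_bij)
  have "card {t \<in> C. fst (h t) = c} = fact (r - 1)" if "c \<in> A" for c
  proof -
    have "h ` {t \<in> C. fst (h t) = c} = {y \<in> h ` C. fst y = c}" by auto
    also have "\<dots> = {c} \<times> {..<fact (r - 1)}"
      using that bij_betw_imp_surj_on[OF h] by auto
    finally have "bij_betw h {t \<in> C. fst (h t) = c} ({c} \<times> {..<fact (r - 1)})"
      by (intro bij_betw_subset[OF h]) auto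
    then show ?thesis using bij_betw_same_card by fastforce
  qed
  moreover have "(fst \<circ> h) ` C \<subseteq> A"
    using bij_betwE[OF h] by (auto simp: mem_Times_iff)
  ultimately show ?case
    using Nil by (intro exI[of _ "fst \<circ> h"]) auto
next
  case (Cons u us)
  define K where "K a = {t \<in> C. u t = a}" for a
  have r: "1 < r" using Cons.prems by simp
  have finC: "finite C" using balanced_finite Cons.prems(1) .
  have finA: "finite A" using Cons.prems r card_ge_0_finite by fastforce
  have cuA: "card (u ` C) = card A"
    using balanced_Cons_card_image[OF Cons.prems(1)] Cons.prems(3) r by simp
  have "matched R (u ` C) A" using Cons.prems by simp
  \<comment> \<open>When the head has colour \<open>a\<close>, the colour deleted is
    \<open>\<phi> a\<close>, the conflicting one if there is any. Bijectivity makes each colour of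
    \<open>A\<close> be deleted for exactly one \<open>a\<close>.\<close>
  then obtain \<phi> where \<phi>: "bij_betw \<phi> (u ` C) A"
      "\<And>a b. a \<in> u ` C \<Longrightarrow> b \<in> A \<Longrightarrow> R a b \<Longrightarrow> \<phi> a = b"
    using matched_extends_bij_betw[OF _ finite_imageI[OF finC] finA cuA] by blast
  have card_del: "card (A - {\<phi> a}) = r - 1" if "a \<in> u ` C" for a
    using Cons.prems(3) bij_betwE[OF \<phi>(1)] that by (metis card_Diff_singleton)
  have "\<exists>x. x ` K a \<subseteq> A - {\<phi> a} \<and> (\<forall>t\<in>K a. \<forall>u\<in>set us. \<not> R (u t) (x t)) \<and>
    (\<forall>i\<le>length us. balanced (r - 1) (K a) (take i us @ x # drop i us))" if a: "a \<in> u ` C" for a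
  proof (rule Cons.IH)
    show "balanced (r - 1) (K a) us" using Cons.prems(1) a unfolding K_def balanced.simps by blast
    show "length us < r - 1" using Cons.prems by simp
    show "card (A - {\<phi> a}) = r - 1" by (rule card_del[OF a])
    show "matched R (v ` K a) (A - {\<phi> a})" if "v \<in> set us" for v
      using Cons.prems(4)[of v] that by (auto simp: K_def intro: matched_subset)
  qed
  then obtain X where X: "\<And>a. a \<in> u ` C \<Longrightarrow> X a ` K a \<subseteq> A - {\<phi> a}"
      "\<And>a t v. a \<in> u ` C \<Longrightarrow> t \<in> K a \<Longrightarrow> v \<in> set us \<Longrightarrow> \<not> R (v t) (X a t)"
      "\<And>a i. a \<in> u ` C \<Longrightarrow> i \<le> length us \<Longrightarrow>
        balanced (r - 1) (K a) (take i us @ X a # drop i us)"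
    by metis
  \<comment> \<open>Glue the solutions of the fibres: on \<open>K a\<close> the head has colour
    \<open>a\<close>, so \<open>x\<close> agrees there with \<open>X a\<close>.\<close>
  define x where "x t = X (u t) t" for t
  have KC: "t \<in> K (u t)" if "t \<in> C" for t using that by (simp add: K_def)
  have sub: "x t \<in> A - {\<phi> (u t)}" if "t \<in> C" for t
    using X(1)[of "u t"] KC that by (auto simp: x_def)
  have bal: "balanced (r - 1) (K a) (take i us @ x # drop i us)"
    if "a \<in> u ` C" "i \<le> length us" for a i
    using X(3)[OF that]
    by (rule balanced_cong[THEN iffD1, rotated])
      (auto simp: x_def K_def intro!: list_all2_appendI list_all2_refl)
  \<comment> \<open>Position \<open>0\<close> in the fibre forces \<open>r - 1\<close> distinct
    values of \<open>x\<close>, which exhaust the \<open>r - 1\<close> colours left after the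
    deletion.\<close>
  have img: "x ` K a = A - {\<phi> a}" if a: "a \<in> u ` C" for a
  proof (rule balanced_Cons_image_eq)
    show "balanced (r - 1) (K a) (x # us)" using bal[OF a, of 0] by simp
    show "card (A - {\<phi> a}) = r - 1" by (rule card_del[OF a])
  qed (use r sub in \<open>auto simp: K_def\<close>)
  have avoid: "\<not> R (v t) (x t)" if "t \<in> C" "v \<in> set (u # us)" for t v
  proof (cases "v = u")
    case True
    then show ?thesis using \<phi>(2)[of "u t" "x t"] sub[OF that(1)] that(1) by auto
  next
    case False
    then show ?thesis using X(2)[of "u t" t v] KC that by (simp add: x_def)
  qed
  \<comment> \<open>Swap the order of conditioning: fix the new colour \<open>c\<close> first and
    count the head colours \<open>a\<close> compatible with it. These are all except the preimage of
    \<open>c\<close> under \<open>\<phi>\<close>, so \<open>r - 1\<close> values with fibres of size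
    \<open>fact (r - 2)\<close>, in total \<open>fact (r - 1)\<close>.\<close>
  have front: "balanced r C (x # u # us)"
  proof -
    have "balanced (r - 1) {t \<in> C. x t = c} (u # us)" if "c \<in> A" for c
    proof -
      define E where "E = {t \<in> C. x t = c}"
      have fib: "{t \<in> E. u t = a} = {t \<in> K a. x t = c}" for a
        by (auto simp: E_def K_def)
      have im: "u ` E = {a \<in> u ` C. \<phi> a \<noteq> c}"
      proof (intro equalityI subsetI)
        fix a assume "a \<in> {a \<in> u ` C. \<phi> a \<noteq> c}"
        then have "c \<in> x ` K a" using img[of a] that by auto
        then show "a \<in> u ` E" by (auto simp: E_def K_def)
      qed (use sub in \<open>force simp: E_def\<close>)
      have sm: "balanced (r - 2) {t \<in> E. u t = a} us" if "a \<in> u ` E" for a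
      proof -
        have "a \<in> u ` C" "c \<in> x ` K a"
          using that by (auto simp: E_def K_def)
        moreover from this have "balanced (r - 1) (K a) (x # us)"
          using bal[of a 0] by simp
        ultimately have "balanced (r - 1 - 1) {t \<in> K a. x t = c} us"
          unfolding balanced.simps by blast
        then show ?thesis by (simp add: fib numeral_2_eq_2)
      qed
      obtain a0 where a0: "a0 \<in> u ` C" "\<phi> a0 = c"
        using \<phi>(1) \<open>c \<in> A\<close> by (auto simp: bij_betw_def)
      have "{a \<in> u ` C. \<phi> a \<noteq> c} = u ` C - {a0}"
        using \<phi>(1) a0 by (auto simp: bij_betw_def inj_on_def)
      then have cu: "card (u ` E) = r - 1"
        using a0 im balanced_Cons_card_image[OF Cons.prems(1)] r finC
        by (simp add: card_Diff_singleton)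
      have "card E = (\<Sum>a\<in>u ` E. card {t \<in> E. u t = a})"
        by (rule card_eq_sum_fibres) (simp add: E_def finC)
      also have "\<dots> = (\<Sum>a\<in>u ` E. fact (r - 2))"
        using sm balanced_card by (intro sum.cong) auto
      also have "\<dots> = fact (r - 1)"
        using cu r fact_reduce[of "r - 1", where 'a = nat] by (simp add: numeral_2_eq_2)
      finally show ?thesis
        using sm by (simp add: E_def[symmetric] numeral_2_eq_2)
    qed
    then show ?thesis
      using sub balanced_card[OF Cons.prems(1)] by auto
  qed
  \<comment> \<open>Position \<open>0\<close> is \<open>front\<close>; a later position lies behind
    \<open>u\<close> and is settled inside the fibres of \<open>u\<close>.\<close>
  have "balanced r C (take i (u # us) @ x # drop i (u # us))" if "i \<le> length (u # us)" for i
    using that front bal balanced_card[OF Cons.prems(1)] by (cases i) (auto simp: K_def)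
  then show ?case
    using sub avoid by blast
qed

section \<open>Ordered insertion and conflicts in a cover\<close>

lemma sorted_wrt_insert_position:
  fixes f :: "'a \<Rightarrow> 'b::linorder"
  assumes "sorted_wrt (\<lambda>a b. f b \<le> f a) ys"
  obtains i where "i \<le> length ys" "sorted_wrt (\<lambda>a b. f b \<le> f a) (take i ys @ x # drop i ys)"
proof -
  have "\<exists>i\<le>length ys. sorted_wrt (\<lambda>a b. f b \<le> f a) (take i ys @ x # drop i ys)"
    using assms
  proof (induction ys)
    case (Cons y ys)
    then obtain i where i: "i \<le> length ys"
        "sorted_wrt (\<lambda>a b. f b \<le> f a) (take i ys @ x # drop i ys)"
      by auto
    show ?case
    proof (cases "f x \<le> f y")
      case True
      then show ?thesis
        using Cons.prems i by (intro exI[of _ "Suc i"]) (auto dest: in_set_takeD in_set_dropD)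
    next
      case False
      then show ?thesis
        using Cons.prems by (intro exI[of _ 0]) auto
    qed
  qed simp
  then show thesis using that by blast
qed

text \<open>Cover edges are unordered pairs. Disjointness of the two lists tells which end lies
  where, so two edges sharing one end must share both. For non-adjacent vertices there is no edge at
  all.\<close>

lemma correspondence_cover_matched:
  assumes "correspondence_cover G L H" "u \<in> pverts G" "v \<in> pverts G" "u \<noteq> v"
  shows "matched (\<lambda>a b. (a, b) \<in> parcs H) (L u) (L v)"
proof (cases "(u, v) \<in> parcs G")
  case True
  have disj: "L u \<inter> L v = {}"
    using assms by (auto simp: correspondence_cover_def disjoint_family_on_def)
  have "matching (edges_between H (L u) (L v))"
    using assms True by (simp add: correspondence_cover_def)
  then have m: "{a, b} = {a', b'} \<or> {a, b} \<inter> {a', b'} = {}"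
    if "a \<in> L u" "b \<in> L v" "(a, b) \<in> parcs H" "a' \<in> L u" "b' \<in> L v" "(a', b') \<in> parcs H"
    for a b a' b'
  proof -
    have "{a, b} \<in> edges_between H (L u) (L v)" "{a', b'} \<in> edges_between H (L u) (L v)"
      using that unfolding edges_between_def by blast+
    then show ?thesis
      using \<open>matching _\<close> unfolding matching_def pairwise_def disjnt_def by metis
  qed
  show ?thesis
    unfolding matched_def
  proof (intro ballI impI)
    fix a a' b b'
    assume *: "a \<in> L u" "a' \<in> L u" "b \<in> L v" "b' \<in> L v"
      "(a, b) \<in> parcs H \<and> (a', b') \<in> parcs H"
    then show "a = a' \<longleftrightarrow> b = b'"
      using m[of a b a' b'] disj by (metis disjoint_iff doubleton_eq_iff insertI1 insertI2)
  qed
next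
  case False
  then have "edges_between H (L u) (L v) = {}"
    using assms by (simp add: correspondence_cover_def)
  then show ?thesis
    by (auto simp: matched_def edges_between_def)
qed

lemma cover_no_edge:
  assumes "correspondence_cover G L H" "u \<in> pverts G" "v \<in> pverts G" "u \<noteq> v"
    "(u, v) \<notin> parcs G" "a \<in> L u" "b \<in> L v"
  shows "(a, b) \<notin> parcs H"
  using assms unfolding correspondence_cover_def edges_between_def by blast

section \<open>Colouring in order of first occurrence\<close>

text \<open>The sweep sees only the interval ends \<open>first\<close> and \<open>last\<close>.
  \<open>F v t\<close> is the colour of \<open>v\<close> in the \<open>t\<close>-th colouring and
  \<open>ys\<close> lists the living vertices. Uniformity of single vertices is carried separately,
  since it does not follow from the balance of a list containing them further back, nor for vertices
  that have left. The final conjunct says that a missing vertex has expired, without naming a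
  current position.\<close>

lemma balanced_colourings:
  fixes G :: "'a pair_pre_digraph" and first last :: "'a \<Rightarrow> nat"
  assumes cov: "correspondence_cover G L H" and fold: "k_fold m G L"
    and G: "pair_graph G"
    and overlap: "\<forall>u v. (u, v) \<in> parcs G \<longrightarrow> first v \<le> last u"
    and clique: "\<forall>x\<in>pverts G.
      card {y \<in> pverts G. y \<noteq> x \<and> first y \<le> first x \<and> first x \<le> last y} < m"
    and V: "V \<subseteq> pverts G"
  shows "\<exists>(F :: 'a \<Rightarrow> nat \<Rightarrow> 'b) ys. (\<forall>v\<in>V. F v ` {..<fact m} \<subseteq> L v) \<and>
    (\<forall>t<fact m. \<forall>u\<in>V. \<forall>v\<in>V. (F u t, F v t) \<notin> parcs H) \<and>
    (\<forall>v\<in>V. balanced m {..<fact m} [F v]) \<and>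
    sorted_wrt (\<lambda>a b. last b \<le> last a) ys \<and> distinct ys \<and> set ys \<subseteq> V \<and>
    balanced m {..<fact m} (map F ys) \<and>
    (\<forall>v\<in>V - set ys. \<exists>w\<in>V. last v < first w)"
proof -
  interpret G: pair_graph G by fact
  interpret H: pair_graph H using cov by (simp add: correspondence_cover_def)
  have "finite V" using V G.pair_finite_verts finite_subset by blast
  then show ?thesis
    using V
  proof (induction V rule: finite_ranking_induct[where f = first])
    case empty
    then show ?case by (intro exI[of _ undefined] exI[of _ "[]"]) simp
  next
    case (insert x S)
    \<comment> \<open>The induction rule orders the vertices by \<open>first\<close> but does not
      exclude that \<open>x\<close> occurred before.\<close>
    show ?case
    proof (cases "x \<in> S")
      case True
      then show ?thesis using insert by (simp add: insert_absorb)
    next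
      case False
      have SG: "S \<subseteq> pverts G" and xG: "x \<in> pverts G" using insert.prems by auto
      from insert.IH[OF SG] obtain F :: "'a \<Rightarrow> nat \<Rightarrow> 'b" and ys
        where F: "\<forall>v\<in>S. F v ` {..<fact m} \<subseteq> L v"
          "\<forall>t<fact m. \<forall>u\<in>S. \<forall>v\<in>S. (F u t, F v t) \<notin> parcs H"
          "\<forall>v\<in>S. balanced m {..<fact m} [F v]"
          "balanced m {..<fact m} (map F ys)"
        and ys: "sorted_wrt (\<lambda>a b. last b \<le> last a) ys" "distinct ys" "set ys \<subseteq> S"
          "\<forall>v\<in>S - set ys. \<exists>w\<in>S. last v < first w"
        by (elim exE conjE) (rule that; assumption)
      note F = F(1)[THEN bspec] F(2)[rule_format] F(3)[THEN bspec] F(4)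
        and ys = ys(1-3) ys(4)[THEN bspec]
      \<comment> \<open>As \<open>ys\<close> is sorted by decreasing \<open>last\<close>, the
        vertices reaching \<open>first x\<close> form a prefix, and balance passes to
        prefixes.\<close>
      define zs where "zs = takeWhile (\<lambda>v. first x \<le> last v) ys"
      have zs_pre: "ys = zs @ dropWhile (\<lambda>v. first x \<le> last v) ys"
        by (simp add: zs_def)
      have "last v < first x" if "v \<in> set (dropWhile (\<lambda>v. first x \<le> last v) ys)" for v
        using ys(1) that by (induction ys) (auto split: if_splits)
      then have dead: "last v < first x" if "v \<in> set ys - set zs" for v
        using that zs_pre by (metis DiffD1 DiffD2 UnE set_append)
      have zs: "sorted_wrt (\<lambda>a b. last b \<le> last a) zs" "distinct zs" "set zs \<subseteq> S"
        using ys zs_pre by (metis sorted_wrt_append, metis distinct_append, metis Un_subset_iff set_append)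
      have alive: "first x \<le> last v" if "v \<in> set zs" for v
        using that set_takeWhileD unfolding zs_def by metis
      \<comment> \<open>A vertex expired earlier ends before \<open>first w\<close> for some
        \<open>w\<close> in \<open>S\<close>, and \<open>first w \<le> first x\<close> by the order
        of the induction.\<close>
      have dead': "last v < first x" if "v \<in> S - set zs" for v
        using that dead ys(4)[of v] insert.hyps(2) by fastforce
      have bal_zs: "balanced m {..<fact m} (map F zs)"
        using F(4) zs_pre by (metis balanced_append1 map_append)
      have neighbours: "set zs \<subseteq> {y \<in> pverts G. y \<noteq> x \<and> first y \<le> first x \<and> first x \<le> last y}"
        using insert.hyps(2) SG zs(3) alive False by auto
      have "card (set zs) < m"
        using card_mono[OF _ neighbours] G.pair_finite_verts clique xG by fastforce
      then have len: "length (map F zs) < m"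
        using zs(2) by (simp add: distinct_card)
      have conflicts: "matched (\<lambda>a b. (a, b) \<in> parcs H) (f ` {..<fact m}) (L x)"
        if "f \<in> set (map F zs)" for f
      proof -
        from that zs(3) have "\<exists>u\<in>S. f = F u" by auto
        then obtain u where u: "u \<in> S" "f = F u" by blast
        then have "matched (\<lambda>a b. (a, b) \<in> parcs H) (L u) (L x)"
          using correspondence_cover_matched[OF cov, of u x] SG xG False by blast
        then show ?thesis
          using F(1)[OF u(1)] unfolding u(2) by (rule matched_subset) simp
      qed
      have cLx: "card (L x) = m"
        using fold xG by (simp add: k_fold_def)
      obtain c where c: "c ` {..<fact m} \<subseteq> L x"
          "\<forall>t\<in>{..<fact m}. \<forall>f\<in>set (map F zs). (f t, c t) \<notin> parcs H"
          "\<forall>i\<le>length (map F zs).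
            balanced m {..<fact m} (take i (map F zs) @ c # drop i (map F zs))"
        using balanced_insert[OF bal_zs len cLx conflicts] by blast
      obtain i where i: "i \<le> length zs"
          "sorted_wrt (\<lambda>a b. last b \<le> last a) (take i zs @ x # drop i zs)"
        using sorted_wrt_insert_position[OF zs(1)] by blast
      \<comment> \<open>Position \<open>0\<close> gives the uniformity of \<open>c\<close>; the
        position \<open>i\<close> continues the sorted list.\<close>
      have "balanced m {..<fact m} ([c] @ map F zs)"
        using c(3)[rule_format, of 0] by (simp only: take0 drop0 append_Cons append_Nil le0)
      then have bal_c: "balanced m {..<fact m} [c]" by (rule balanced_append1)
      define F' where "F' = F(x := c)"
      define xs where "xs = take i zs @ x # drop i zs"
      have F'S: "F' v = F v" if "v \<in> S" for v
        using that False by (auto simp: F'_def)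
      have F'x: "F' x = c" by (simp add: F'_def)
      have sym: "(b, a) \<notin> parcs H" if "(a, b) \<notin> parcs H" for a b
        using that H.pair_sym_arcs by (auto simp: symmetric_def sym_def)
      have ux: "(F u t, c t) \<notin> parcs H" if "u \<in> S" "t < fact m" for u t
      proof (cases "u \<in> set zs")
        case True
        then show ?thesis using c(2) that by auto
      next
        case nz: False
        \<comment> \<open>Adjacent vertices have overlapping intervals, but \<open>u\<close> ends
          before \<open>x\<close> begins.\<close>
        then have "(u, x) \<notin> parcs G" using dead'[of u] that overlap by fastforce
        then show ?thesis
          using cover_no_edge[OF cov, of u x "F u t" "c t"] F(1)[of u] c(1) insert.prems False that
          by auto
      qed
      have setxs: "set xs = insert x (set zs)"
      proof -
        have "set xs = insert x (set (take i zs @ drop i zs))"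
          unfolding xs_def by (simp del: append_take_drop_id)
        then show ?thesis by simp
      qed
      show ?thesis
      proof (intro exI[of _ F'] exI[of _ xs] conjI ballI allI impI)
        show "F' v ` {..<fact m} \<subseteq> L v" if "v \<in> insert x S" for v
          using that F(1)[of v] c(1) F'S[of v] F'x by (cases "v = x") auto
        show "(F' u t, F' v t) \<notin> parcs H" if "t < fact m" "u \<in> insert x S" "v \<in> insert x S" for t u v
          using that F(2) ux sym F'S F'x H.pair_no_loops by fastforce
        show "balanced m {..<fact m} [F' v]" if "v \<in> insert x S" for v
          using that F(3)[of v] F'S[of v] F'x bal_c by (metis insertE)
        show "sorted_wrt (\<lambda>a b. last b \<le> last a) xs" using i by (simp add: xs_def)
        show "distinct xs"
        proof -
          have "distinct (take i zs @ drop i zs)" using zs(2) by simp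
          moreover have "x \<notin> set (take i zs @ drop i zs)" using zs(3) False by auto
          ultimately show ?thesis
            unfolding xs_def by (auto simp del: append_take_drop_id)
        qed
        show "set xs \<subseteq> insert x S" using setxs zs(3) by auto
        have "map F' zs = map F zs"
          using F'S zs(3) by auto
        then have "map F' xs = take i (map F zs) @ c # drop i (map F zs)"
          by (simp only: xs_def map_append list.map F'x flip: take_map drop_map)
        then show "balanced m {..<fact m} (map F' xs)"
          using c(3) i by auto
        \<comment> \<open>The witness is always \<open>x\<close>, by \<open>dead'\<close>.\<close>
        show "\<exists>w\<in>insert x S. last v < first w" if "v \<in> insert x S - set xs" for v
          using that dead' setxs by auto
      qed
    qed
  qed
qed

section \<open>From a path decomposition to a fractional packing\<close>

lemma packing_of_small_bags:
  fixes L :: "'a \<Rightarrow> 'b set"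
  assumes G: "pair_graph G" and dec: "path_decomposition G Xs"
    and small: "\<And>X. X \<in> set Xs \<Longrightarrow> card X \<le> m"
    and cov: "correspondence_cover G L H" and fold: "k_fold m G L"
  shows "admits_fractional_packing G L H"
proof -
  interpret G: pair_graph G by fact
  have bag_cover: "\<exists>X\<in>set Xs. v \<in> X" if "v \<in> pverts G" for v
    using dec that by (simp add: path_decomposition_def)
  have bag_edge: "\<exists>X\<in>set Xs. u \<in> X \<and> v \<in> X" if "(u, v) \<in> parcs G" for u v
    using dec that by (simp add: path_decomposition_def)
  have bag_interval: "v \<in> Xs ! j"
    if "v \<in> pverts G" "i \<le> j" "j \<le> l" "l < length Xs" "v \<in> Xs ! i" "v \<in> Xs ! l" for v i j l
    using dec that unfolding path_decomposition_def by metis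
  have bag_finite: "finite X" if "X \<in> set Xs" for X
  proof (rule finite_subset)
    show "X \<subseteq> pverts G" using dec that by (simp add: path_decomposition_def)
  qed (rule G.pair_finite_verts)
  define pos where "pos v = {i. i < length Xs \<and> v \<in> Xs ! i}" for v
  have fin_pos: "finite (pos v)" for v by (simp add: pos_def)
  have pos_le: "Min (pos v) \<le> i" "i \<le> Max (pos v)" if "i \<in> pos v" for i v
    using that fin_pos by auto
  have ne_pos: "pos v \<noteq> {}" if "v \<in> pverts G" for v
    using bag_cover[OF that] by (auto simp: pos_def in_set_conv_nth)
  have pos_first: "Min (pos v) \<in> pos v" "Max (pos v) \<in> pos v" if "v \<in> pverts G" for v
    using ne_pos[OF that] fin_pos by auto
  have pos_between: "v \<in> Xs ! j" if "v \<in> pverts G" "Min (pos v) \<le> j" "j \<le> Max (pos v)" for v j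
    using bag_interval[OF that] pos_first[OF that(1)] by (simp add: pos_def)
  have overlap: "\<forall>u v. (u, v) \<in> parcs G \<longrightarrow> Min (pos v) \<le> Max (pos u)"
  proof (intro allI impI)
    fix u v assume "(u, v) \<in> parcs G"
    then obtain i where "i \<in> pos u" "i \<in> pos v"
      using bag_edge[of u v] by (auto simp: pos_def in_set_conv_nth)
    then show "Min (pos v) \<le> Max (pos u)" using pos_le order_trans by blast
  qed
  have clique: "\<forall>x\<in>pverts G.
    card {y \<in> pverts G. y \<noteq> x \<and> Min (pos y) \<le> Min (pos x) \<and> Min (pos x) \<le> Max (pos y)} < m"
    (is "\<forall>x\<in>_. card (?Y x) < m")
  proof
    fix x assume x: "x \<in> pverts G"
    let ?X = "Xs ! Min (pos x)"
    have X: "?X \<in> set Xs" "x \<in> ?X" using pos_first(1)[OF x] by (auto simp: pos_def)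
    \<comment> \<open>All these intervals contain the index at which \<open>x\<close> first occurs,
      so that single bag holds them together with \<open>x\<close>. Counting \<open>x\<close> itself
      makes the bound on the others strict.\<close>
    have "insert x (?Y x) \<subseteq> ?X" using X(2) pos_between by blast
    then have "card (insert x (?Y x)) \<le> m"
      using small[OF X(1)] card_mono[OF bag_finite[OF X(1)]] order_trans by blast
    then show "card (?Y x) < m" using G.pair_finite_verts by simp
  qed
  from balanced_colourings[where first = "\<lambda>v. Min (pos v)" and last = "\<lambda>v. Max (pos v)",
      OF cov fold G overlap clique order.refl]
  obtain F :: "'a \<Rightarrow> nat \<Rightarrow> 'b"
    where "\<forall>v\<in>pverts G. F v ` {..<fact m} \<subseteq> L v"
      "\<forall>t<fact m. \<forall>u\<in>pverts G. \<forall>v\<in>pverts G. (F u t, F v t) \<notin> parcs H"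
      "\<forall>v\<in>pverts G. balanced m {..<fact m} [F v]"
    by (elim exE conjE) (rule that; assumption)
  note F = this(1)[THEN bspec] this(2)[rule_format] this(3)[THEN bspec]
  have LH: "L v \<subseteq> pverts H" if "v \<in> pverts G" for v
    using cov that by (auto simp: correspondence_cover_def)
  \<comment> \<open>The random transversal is \<open>T t\<close> for a uniformly random index
    \<open>t\<close>, so colourings that repeat receive proportionally more weight.\<close>
  define T where "T t = (\<lambda>v. F v t) ` pverts G" for t
  define I where "I = {..<fact m :: nat}"
  have I: "finite I" "I \<noteq> {}" by (auto simp: I_def lessThan_empty_iff)
  show ?thesis
    unfolding admits_fractional_packing_def
  proof (intro exI conjI ballI)
    fix J assume "J \<in> set_pmf (map_pmf T (pmf_of_set I))"
    then obtain t where t: "t < fact m" "J = T t" using I by (auto simp: I_def)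
    have FL: "F v t \<in> L v" if "v \<in> pverts G" for v using F(1)[OF that] t by auto
    have "J \<inter> L v = {F v t}" if v: "v \<in> pverts G" for v
    proof -
      have "L u \<inter> L v = {}" if "u \<in> pverts G" "u \<noteq> v" for u
        using cov v that by (auto simp: correspondence_cover_def disjoint_family_on_def)
      then show ?thesis using FL v unfolding t(2) T_def by blast
    qed
    moreover have "independent_set H J"
      using FL LH F(2) t by (auto simp: independent_set_def T_def)
    ultimately show "independent_transversal G L H J"
      by (simp add: independent_transversal_def)
  next
    fix v x assume v: "v \<in> pverts G" and x: "x \<in> L v"
    have cL: "card (L v) = m" using fold v by (simp add: k_fold_def)
    \<comment> \<open>The strict bound in \<open>clique\<close>, applied to \<open>v\<close>,
      excludes \<open>m = 0\<close>.\<close>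
    have m: "0 < m" using clique v by fastforce
    have "F v ` I = L v"
      unfolding I_def using balanced_Cons_image_eq[OF F(3)[OF v] m F(1)[OF v] cL] .
    then have "card {t \<in> I. F v t = x} = fact (m - 1)"
      using F(3)[OF v] x by (auto simp: I_def)
    then have "1 / real m = card (I \<inter> {t. F v t = x}) / card I"
      using fact_reduce[OF m, where 'a = real] m by (simp add: I_def Int_def)
    also have "\<dots> = measure_pmf.prob (pmf_of_set I) {t. F v t = x}"
      using I by (simp add: measure_pmf_of_set)
    \<comment> \<open>Giving \<open>v\<close> the colour \<open>x\<close> puts \<open>x\<close> into
      the transversal; this inclusion of events yields the lower bound.\<close>
    also have "\<dots> \<le> measure_pmf.prob (pmf_of_set I) (T -` {J. x \<in> J})"
      by (rule measure_pmf.finite_measure_mono) (use v in \<open>auto simp: T_def\<close>)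
    finally show "1 / real (card (L v)) \<le> measure_pmf.prob (map_pmf T (pmf_of_set I)) {J. x \<in> J}"
      by (simp add: cL)
  qed
qed

theorem theorem2p3:
  fixes G :: "'a pair_pre_digraph" and k :: int
  assumes "pair_graph G"
    and "pathwidth G = k"
  shows "int (fractional_correspondence_packing_number G) \<le> k + 1"
proof -
  have "k \<in> {decomposition_width Xs | Xs. path_decomposition G Xs}"
    using Min_in[OF path_decomposition_widths[OF assms(1)]] assms(2) by (simp add: pathwidth_def)
  then obtain Xs where Xs: "path_decomposition G Xs" "decomposition_width Xs = k"
    by blast
  have bag: "int (card X) \<le> k + 1" if "X \<in> set Xs" for X
    using Xs(2) that by (auto simp: decomposition_width_def intro!: Max_ge)
  \<comment> \<open>Some bag exists and its size is nonnegative, so \<open>k \<ge> -1\<close> and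
    \<open>nat (k + 1)\<close> truncates nothing, even for the null graph.\<close>
  obtain X where "X \<in> set Xs"
    using Xs(1) unfolding path_decomposition_def by (metis last_in_set)
  then have k: "0 \<le> k + 1"
    using bag order_trans of_nat_0_le_iff by blast
  have "fractional_correspondence_packing_number G \<le> nat (k + 1)"
    unfolding fractional_correspondence_packing_number_def
  proof (rule Least_le, intro allI impI)
    fix L :: "'a \<Rightarrow> nat set" and H
    assume "correspondence_cover G L H \<and> k_fold (nat (k + 1)) G L"
    then show "admits_fractional_packing G L H"
      using packing_of_small_bags[OF assms(1) Xs(1), of "nat (k + 1)"] bag by fastforce
  qed
  then show ?thesis using k by simp
qed

end
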